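(* An algebra $\mathbf{A}=\langle A,\vee,*,\neg_r,\neg_l,0,1\rangle$ of type $\langle 2,2,1,1,0,0\rangle$ belongs to $\mathbb{PM}^{sl}$ if and only if it satisfies: (1) a set of equations defining semilatticed monoids (i.e. $\langle A,\vee\rangle$ is a semilattice, $\langle A,*,1\rangle$ is a monoid, and $x*(y\vee z)\approx(x*y)\vee(x*z)$, $(y\vee z)*x\approx(y*x)\vee(z*x)$); (2) the equations $\neg_r 1\approx 0$, $1\vee\neg_r 0\approx\neg_r 0$, $(x*\neg_r(y*x))\vee\neg_r y\approx\neg_r y$, $\neg_l 1\approx 0$, $1\vee\neg_l 0\approx\neg_l 0$, $((\neg_l(x*y))*x)\vee\neg_l y\approx\neg_l y$; and (3) the equations $\neg_r(x\vee y)\vee\neg_r x\approx\neg_r x$ and $\neg_l(x\vee y)\vee\neg_l x\approx\neg_l x$. In particular, $\mathbb{PM}^{sl}$ is a variety.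
   Context: $\mathbb{PM}^{sl}$ is the class of algebras $\langle A,\vee,*,\neg_r,\neg_l,0,1\rangle$ such that $\langle A,\vee\rangle$ is a join-semilattice, $\langle A,*,1\rangle$ is a monoid, $*$ distributes over $\vee$ on both sides, $0$ is an arbitrary element, and, writing $a\le b$ for $a\vee b=b$, for all $a,b\in A$: $a*b\le0$ iff $b\le\neg_r a$ iff $a\le\neg_l b$. *)

theory Defs
  imports "HOL-Algebra.Group"
begin

record 'a pm_algebra = "'a monoid" +
  sjoin :: "['a, 'a] \<Rightarrow> 'a" (infixl \<open>\<uplus>\<index>\<close> 65)
  rneg :: "'a \<Rightarrow> 'a" (\<open>\<not>\<^sub>r\<index> _\<close> [81] 80)
  lneg :: "'a \<Rightarrow> 'a" (\<open>\<not>\<^sub>l\<index> _\<close> [81] 80)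
  zero :: 'a (\<open>\<zero>\<index>\<close>)

text \<open>An arbitrary algebra of type (2,2,1,1,0,0) whose universe is \<open>carrier A\<close>: the operations
  need only be closed there, and their values outside are irrelevant. The universe is nonempty
  because it contains the constants.\<close>

locale type_algebra =
  fixes A :: "'a pm_algebra" (structure)
  assumes sjoin_closed: "\<lbrakk>x \<in> carrier A; y \<in> carrier A\<rbrakk> \<Longrightarrow> x \<uplus> y \<in> carrier A"
    and mult_closed: "\<lbrakk>x \<in> carrier A; y \<in> carrier A\<rbrakk> \<Longrightarrow> x \<otimes> y \<in> carrier A"
    and rneg_closed: "x \<in> carrier A \<Longrightarrow> \<not>\<^sub>r x \<in> carrier A"
    and lneg_closed: "x \<in> carrier A \<Longrightarrow> \<not>\<^sub>l x \<in> carrier A"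
    and zero_closed: "\<zero> \<in> carrier A"
    and unit_closed: "\<one> \<in> carrier A"

definition sle :: "'a pm_algebra \<Rightarrow> 'a \<Rightarrow> 'a \<Rightarrow> bool" (\<open>(_/ \<unlhd>\<index> _)\<close> [51, 51] 50)
  where "x \<unlhd>\<^bsub>A\<^esub> y \<longleftrightarrow> x \<uplus>\<^bsub>A\<^esub> y = y"

locale pmsl_algebra = type_algebra A + monoid A for A :: "'a pm_algebra" (structure) +
  assumes sjoin_assoc: "\<lbrakk>x \<in> carrier A; y \<in> carrier A; z \<in> carrier A\<rbrakk>
      \<Longrightarrow> (x \<uplus> y) \<uplus> z = x \<uplus> (y \<uplus> z)"
    and sjoin_comm: "\<lbrakk>x \<in> carrier A; y \<in> carrier A\<rbrakk> \<Longrightarrow> x \<uplus> y = y \<uplus> x"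
    and sjoin_idem: "x \<in> carrier A \<Longrightarrow> x \<uplus> x = x"
    and mult_sjoin_distrib: "\<lbrakk>x \<in> carrier A; y \<in> carrier A; z \<in> carrier A\<rbrakk>
      \<Longrightarrow> x \<otimes> (y \<uplus> z) = (x \<otimes> y) \<uplus> (x \<otimes> z)"
    and sjoin_mult_distrib: "\<lbrakk>x \<in> carrier A; y \<in> carrier A; z \<in> carrier A\<rbrakk>
      \<Longrightarrow> (y \<uplus> z) \<otimes> x = (y \<otimes> x) \<uplus> (z \<otimes> x)"
    and rneg_iff: "\<lbrakk>a \<in> carrier A; b \<in> carrier A\<rbrakk> \<Longrightarrow> a \<otimes> b \<unlhd> \<zero> \<longleftrightarrow> b \<unlhd> \<not>\<^sub>r a"
    and lneg_iff: "\<lbrakk>a \<in> carrier A; b \<in> carrier A\<rbrakk> \<Longrightarrow> a \<otimes> b \<unlhd> \<zero> \<longleftrightarrow> a \<unlhd> \<not>\<^sub>l b"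

definition PMsl :: "'a pm_algebra set"
  where "PMsl = {A. pmsl_algebra A}"


datatype trm =
    Var nat
  | Join trm trm (infixl \<open>\<^bold>\<or>\<close> 65)
  | Mult trm trm (infixl \<open>\<^bold>*\<close> 70)
  | NegR trm (\<open>\<^bold>\<not>\<^sub>r _\<close> [81] 80)
  | NegL trm (\<open>\<^bold>\<not>\<^sub>l _\<close> [81] 80)
  | Zero (\<open>\<^bold>0\<close>)
  | One (\<open>\<^bold>1\<close>)

datatype equation = Equation trm trm (infix \<open>\<^bold>\<approx>\<close> 50)

primrec eval :: "'a pm_algebra \<Rightarrow> (nat \<Rightarrow> 'a) \<Rightarrow> trm \<Rightarrow> 'a" where
  "eval A v (Var n) = v n"
| "eval A v (s \<^bold>\<or> t) = eval A v s \<uplus>\<^bsub>A\<^esub> eval A v t"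
| "eval A v (s \<^bold>* t) = eval A v s \<otimes>\<^bsub>A\<^esub> eval A v t"
| "eval A v (\<^bold>\<not>\<^sub>r t) = \<not>\<^sub>r\<^bsub>A\<^esub> eval A v t"
| "eval A v (\<^bold>\<not>\<^sub>l t) = \<not>\<^sub>l\<^bsub>A\<^esub> eval A v t"
| "eval A v \<^bold>0 = \<zero>\<^bsub>A\<^esub>"
| "eval A v \<^bold>1 = \<one>\<^bsub>A\<^esub>"

primrec holds_in :: "'a pm_algebra \<Rightarrow> equation \<Rightarrow> bool" where
  "holds_in A (s \<^bold>\<approx> t) \<longleftrightarrow> (\<forall>v \<in> UNIV \<rightarrow> carrier A. eval A v s = eval A v t)"

definition satisfies :: "'a pm_algebra \<Rightarrow> equation set \<Rightarrow> bool"
  where "satisfies A E \<longleftrightarrow> (\<forall>e \<in> E. holds_in A e)"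

definition semilatticed_monoid_eqs :: "equation set" where
  "semilatticed_monoid_eqs =
    (let x = Var 0; y = Var 1; z = Var 2 in
     {(x \<^bold>\<or> y) \<^bold>\<or> z \<^bold>\<approx> x \<^bold>\<or> (y \<^bold>\<or> z),
      x \<^bold>\<or> y \<^bold>\<approx> y \<^bold>\<or> x,
      x \<^bold>\<or> x \<^bold>\<approx> x,
      (x \<^bold>* y) \<^bold>* z \<^bold>\<approx> x \<^bold>* (y \<^bold>* z),
      \<^bold>1 \<^bold>* x \<^bold>\<approx> x,
      x \<^bold>* \<^bold>1 \<^bold>\<approx> x,
      x \<^bold>* (y \<^bold>\<or> z) \<^bold>\<approx> (x \<^bold>* y) \<^bold>\<or> (x \<^bold>* z),
      (y \<^bold>\<or> z) \<^bold>* x \<^bold>\<approx> (y \<^bold>* x) \<^bold>\<or> (z \<^bold>* x)})"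

definition negation_eqs :: "equation set" where
  "negation_eqs =
    (let x = Var 0; y = Var 1 in
     {\<^bold>\<not>\<^sub>r \<^bold>1 \<^bold>\<approx> \<^bold>0,
      \<^bold>1 \<^bold>\<or> \<^bold>\<not>\<^sub>r \<^bold>0 \<^bold>\<approx> \<^bold>\<not>\<^sub>r \<^bold>0,
      (x \<^bold>* \<^bold>\<not>\<^sub>r (y \<^bold>* x)) \<^bold>\<or> \<^bold>\<not>\<^sub>r y \<^bold>\<approx> \<^bold>\<not>\<^sub>r y,
      \<^bold>\<not>\<^sub>l \<^bold>1 \<^bold>\<approx> \<^bold>0,
      \<^bold>1 \<^bold>\<or> \<^bold>\<not>\<^sub>l \<^bold>0 \<^bold>\<approx> \<^bold>\<not>\<^sub>l \<^bold>0,
      ((\<^bold>\<not>\<^sub>l (x \<^bold>* y)) \<^bold>* x) \<^bold>\<or> \<^bold>\<not>\<^sub>l y \<^bold>\<approx> \<^bold>\<not>\<^sub>l y})"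

definition antitone_eqs :: "equation set" where
  "antitone_eqs =
    (let x = Var 0; y = Var 1 in
     {\<^bold>\<not>\<^sub>r (x \<^bold>\<or> y) \<^bold>\<or> \<^bold>\<not>\<^sub>r x \<^bold>\<approx> \<^bold>\<not>\<^sub>r x,
      \<^bold>\<not>\<^sub>l (x \<^bold>\<or> y) \<^bold>\<or> \<^bold>\<not>\<^sub>l x \<^bold>\<approx> \<^bold>\<not>\<^sub>l x})"


text \<open>A variety is a class of algebras axiomatised by equations, equivalently (Birkhoff) one closed
  under homomorphic images, subalgebras and products. A HOL predicate only sees the algebras over
  one type of elements, while images and products change that type. The closure conditions
  therefore take a separate copy of the class at each type involved.\<close>

definition equational_class :: "'a pm_algebra set \<Rightarrow> bool"
  where "equational_class K \<longleftrightarrow> (\<exists>E. K = {A. type_algebra A \<and> satisfies A E})"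

definition alg_hom :: "'a pm_algebra \<Rightarrow> 'b pm_algebra \<Rightarrow> ('a \<Rightarrow> 'b) set" where
  "alg_hom A B = {h \<in> hom A B.
     (\<forall>x \<in> carrier A. \<forall>y \<in> carrier A. h (x \<uplus>\<^bsub>A\<^esub> y) = h x \<uplus>\<^bsub>B\<^esub> h y) \<and>
     (\<forall>x \<in> carrier A. h (\<not>\<^sub>r\<^bsub>A\<^esub> x) = \<not>\<^sub>r\<^bsub>B\<^esub> h x) \<and>
     (\<forall>x \<in> carrier A. h (\<not>\<^sub>l\<^bsub>A\<^esub> x) = \<not>\<^sub>l\<^bsub>B\<^esub> h x) \<and>
     h \<zero>\<^bsub>A\<^esub> = \<zero>\<^bsub>B\<^esub> \<and> h \<one>\<^bsub>A\<^esub> = \<one>\<^bsub>B\<^esub>}"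

definition closed_under_images :: "'a pm_algebra set \<Rightarrow> 'b pm_algebra set \<Rightarrow> bool" where
  "closed_under_images K K' \<longleftrightarrow>
    (\<forall>A \<in> K. \<forall>B. type_algebra B \<and> (\<exists>h \<in> alg_hom A B. h ` carrier A = carrier B) \<longrightarrow> B \<in> K')"

definition closed_under_subalgebras :: "'a pm_algebra set \<Rightarrow> bool" where
  "closed_under_subalgebras K \<longleftrightarrow>
    (\<forall>A \<in> K. \<forall>S. S \<subseteq> carrier A \<and> type_algebra (A\<lparr>carrier := S\<rparr>) \<longrightarrow> A\<lparr>carrier := S\<rparr> \<in> K)"

definition prod_algebra :: "'i set \<Rightarrow> ('i \<Rightarrow> 'a pm_algebra) \<Rightarrow> ('i \<Rightarrow> 'a) pm_algebra" where
  "prod_algebra I F =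
    \<lparr>carrier = (\<Pi>\<^sub>E i\<in>I. carrier (F i)),
     mult = (\<lambda>f g. \<lambda>i\<in>I. f i \<otimes>\<^bsub>F i\<^esub> g i),
     one = (\<lambda>i\<in>I. \<one>\<^bsub>F i\<^esub>),
     sjoin = (\<lambda>f g. \<lambda>i\<in>I. f i \<uplus>\<^bsub>F i\<^esub> g i),
     rneg = (\<lambda>f. \<lambda>i\<in>I. \<not>\<^sub>r\<^bsub>F i\<^esub> f i),
     lneg = (\<lambda>f. \<lambda>i\<in>I. \<not>\<^sub>l\<^bsub>F i\<^esub> f i),
     zero = (\<lambda>i\<in>I. \<zero>\<^bsub>F i\<^esub>)\<rparr>"

definition closed_under_products :: "'a pm_algebra set \<Rightarrow> ('i \<Rightarrow> 'a) pm_algebra set \<Rightarrow> bool" where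
  "closed_under_products K K' \<longleftrightarrow>
    (\<forall>(I :: 'i set) F. (\<forall>i \<in> I. F i \<in> K) \<longrightarrow> prod_algebra I F \<in> K')"

end

theory Submission imports Defs begin

text \<open>If \<open>a * b \<le> 0\<close>, then antitonicity gives \<open>1 \<le> \<not>\<^sub>r 0 \<le> \<not>\<^sub>r (a * b)\<close>, hence
  \<open>b = b * 1 \<le> b * \<not>\<^sub>r (a * b) \<le> \<not>\<^sub>r a\<close>. Conversely, if \<open>b \<le> \<not>\<^sub>r a\<close>, then
  \<open>a * b \<le> a * \<not>\<^sub>r (1 * a) \<le> \<not>\<^sub>r 1 = 0\<close>. The left negation is dual.\<close>

lemma satisfies_Un: "satisfies A (E \<union> F) \<longleftrightarrow> satisfies A E \<and> satisfies A F"
  by (auto simp: satisfies_def)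

text \<open>The equations in question use at most the variables 0, 1 and 2, so this single valuation
  turns each of them into a law for arbitrary \<open>x\<close>, \<open>y\<close>, \<open>z\<close>.
  Every further index goes to \<open>z\<close>, which keeps the valuation inside the
  carrier.\<close>

lemma holds_inD:
  assumes "holds_in A (s \<^bold>\<approx> t)" "x \<in> carrier A" "y \<in> carrier A" "z \<in> carrier A"
  shows "eval A (\<lambda>n. if n = 0 then x else if n = 1 then y else z) s =
    eval A (\<lambda>n. if n = 0 then x else if n = 1 then y else z) t"
  using assms by (simp add: Pi_iff)

section \<open>From the residuation laws to the equations\<close>

context pmsl_algebra
begin

lemma sle_refl: "x \<in> carrier A \<Longrightarrow> x \<unlhd> x"
  by (simp add: sle_def sjoin_idem)

lemma sle_antisym:
  assumes "x \<in> carrier A" "y \<in> carrier A" "x \<unlhd> y" "y \<unlhd> x"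
  shows "x = y"
  using assms sjoin_comm[of x y] by (simp add: sle_def)

text \<open>As \<open>\<one>\<close> is a unit, residuation with \<open>a = \<one>\<close> says that
  the elements below \<open>\<zero>\<close> are exactly those below
  \<open>\<not>\<^sub>r \<one>\<close>. Applied to these two elements themselves, it gives both
  inequalities.\<close>

lemma rneg_one: "\<not>\<^sub>r \<one> = \<zero>"
proof (rule sle_antisym)
  show "\<not>\<^sub>r \<one> \<unlhd> \<zero>"
    using rneg_iff[of \<one> "\<not>\<^sub>r \<one>"] by (simp add: rneg_closed sle_refl)
  show "\<zero> \<unlhd> \<not>\<^sub>r \<one>"
    using rneg_iff[of \<one> \<zero>] by (simp add: zero_closed sle_refl)
qed (simp_all add: rneg_closed zero_closed)

lemma lneg_one: "\<not>\<^sub>l \<one> = \<zero>"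
proof (rule sle_antisym)
  show "\<not>\<^sub>l \<one> \<unlhd> \<zero>"
    using lneg_iff[of "\<not>\<^sub>l \<one>" \<one>] by (simp add: lneg_closed sle_refl)
  show "\<zero> \<unlhd> \<not>\<^sub>l \<one>"
    using lneg_iff[of \<zero> \<one>] by (simp add: zero_closed sle_refl)
qed (simp_all add: lneg_closed zero_closed)

lemma one_le_rneg_zero: "\<one> \<unlhd> \<not>\<^sub>r \<zero>"
  using rneg_iff[of \<zero> \<one>] by (simp add: zero_closed sle_refl)

lemma one_le_lneg_zero: "\<one> \<unlhd> \<not>\<^sub>l \<zero>"
  using lneg_iff[of \<one> \<zero>] by (simp add: zero_closed sle_refl)

lemma mult_rneg_le: "x \<in> carrier A \<Longrightarrow> x \<otimes> \<not>\<^sub>r x \<unlhd> \<zero>"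
  by (simp add: rneg_iff rneg_closed sle_refl)

lemma lneg_mult_le: "x \<in> carrier A \<Longrightarrow> \<not>\<^sub>l x \<otimes> x \<unlhd> \<zero>"
  by (simp add: lneg_iff lneg_closed sle_refl)

text \<open>Reassociating \<open>(y \<otimes> x) \<otimes> \<not>\<^sub>r (y \<otimes> x) \<unlhd>
  \<zero>\<close> isolates \<open>y\<close> as the left factor, and residuation then moves it to the
  other side.\<close>

lemma mult_rneg_mult_le:
  assumes "x \<in> carrier A" "y \<in> carrier A"
  shows "x \<otimes> \<not>\<^sub>r (y \<otimes> x) \<unlhd> \<not>\<^sub>r y"
  using mult_rneg_le[of "y \<otimes> x"] rneg_iff[of y "x \<otimes> \<not>\<^sub>r (y \<otimes> x)"] assms
  by (simp add: rneg_closed m_assoc)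

lemma lneg_mult_mult_le:
  assumes "x \<in> carrier A" "y \<in> carrier A"
  shows "\<not>\<^sub>l (x \<otimes> y) \<otimes> x \<unlhd> \<not>\<^sub>l y"
  using lneg_mult_le[of "x \<otimes> y"] lneg_iff[of "\<not>\<^sub>l (x \<otimes> y) \<otimes> x" y] assms
  by (simp add: lneg_closed m_assoc)

lemma sle_sjoin1_trans:
  assumes "x \<in> carrier A" "y \<in> carrier A" "z \<in> carrier A" "x \<uplus> y \<unlhd> z"
  shows "x \<unlhd> z"
  using assms by (metis sle_def sjoin_assoc sjoin_closed sjoin_idem)

text \<open>Distributivity splits \<open>(x \<uplus> y) \<otimes> ?n \<unlhd> \<zero>\<close> into a
  join, whose first part \<open>x \<otimes> ?n\<close> is then below \<open>\<zero>\<close> too;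
  residuation finishes.\<close>

lemma rneg_sjoin_le:
  assumes "x \<in> carrier A" "y \<in> carrier A"
  shows "\<not>\<^sub>r (x \<uplus> y) \<unlhd> \<not>\<^sub>r x"
proof -
  let ?n = "\<not>\<^sub>r (x \<uplus> y)"
  have n: "?n \<in> carrier A"
    using assms by (simp add: rneg_closed sjoin_closed)
  then have "(x \<otimes> ?n) \<uplus> (y \<otimes> ?n) \<unlhd> \<zero>"
    using mult_rneg_le[of "x \<uplus> y"] assms by (simp add: sjoin_mult_distrib sjoin_closed)
  then have "x \<otimes> ?n \<unlhd> \<zero>"
    using sle_sjoin1_trans assms n by (meson m_closed zero_closed)
  then show ?thesis
    using rneg_iff assms n by blast
qed

lemma lneg_sjoin_le:
  assumes "x \<in> carrier A" "y \<in> carrier A"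
  shows "\<not>\<^sub>l (x \<uplus> y) \<unlhd> \<not>\<^sub>l x"
proof -
  let ?n = "\<not>\<^sub>l (x \<uplus> y)"
  have n: "?n \<in> carrier A"
    using assms by (simp add: lneg_closed sjoin_closed)
  then have "(?n \<otimes> x) \<uplus> (?n \<otimes> y) \<unlhd> \<zero>"
    using lneg_mult_le[of "x \<uplus> y"] assms by (simp add: mult_sjoin_distrib sjoin_closed)
  then have "?n \<otimes> x \<unlhd> \<zero>"
    using sle_sjoin1_trans assms n by (meson m_closed zero_closed)
  then show ?thesis
    using lneg_iff assms n by blast
qed

lemma satisfies_semilatticed_monoid_eqs: "satisfies A semilatticed_monoid_eqs"
  by (simp add: satisfies_def semilatticed_monoid_eqs_def Let_def Pi_iff sjoin_assoc
      sjoin_idem m_assoc mult_sjoin_distrib sjoin_mult_distrib)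
    (auto simp: Pi_iff intro: sjoin_comm)

lemma satisfies_negation_eqs: "satisfies A negation_eqs"
  using rneg_one lneg_one one_le_rneg_zero one_le_lneg_zero mult_rneg_mult_le lneg_mult_mult_le
  by (simp add: satisfies_def negation_eqs_def Let_def Pi_iff sle_def)

lemma satisfies_antitone_eqs: "satisfies A antitone_eqs"
  using rneg_sjoin_le lneg_sjoin_le
  by (simp add: satisfies_def antitone_eqs_def Let_def Pi_iff sle_def)

end

section \<open>From the equations back to residuation\<close>

lemma pmsl_algebraI:
  fixes A :: "'a pm_algebra" (structure)
  assumes "type_algebra A"
    and lattice: "satisfies A semilatticed_monoid_eqs"
    and neg: "satisfies A negation_eqs"
    and anti: "satisfies A antitone_eqs"
  shows "pmsl_algebra A"
proof -
  interpret type_algebra A by fact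
  note closed = sjoin_closed mult_closed rneg_closed lneg_closed zero_closed unit_closed
  \<comment> \<open>Each instantiation takes three elements of the carrier, so laws in fewer
    variables are later given repeated arguments, as in \<open>monoid(3)[of b b b]\<close>.\<close>
  have join: "(x \<uplus> y) \<uplus> z = x \<uplus> (y \<uplus> z)" "x \<uplus> y = y \<uplus> x" "x \<uplus> x = x"
    and monoid: "(x \<otimes> y) \<otimes> z = x \<otimes> (y \<otimes> z)" "\<one> \<otimes> x = x" "x \<otimes> \<one> = x"
    and distrib: "x \<otimes> (y \<uplus> z) = (x \<otimes> y) \<uplus> (x \<otimes> z)"
      "(y \<uplus> z) \<otimes> x = (y \<otimes> x) \<uplus> (z \<otimes> x)"
    if "x \<in> carrier A" "y \<in> carrier A" "z \<in> carrier A" for x y z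
    using lattice[unfolded satisfies_def semilatticed_monoid_eqs_def Let_def]
    by (auto dest!: holds_inD[OF _ that] simp del: holds_in.simps)
  \<comment> \<open>These equations have at most two variables; the third slot of
    \<open>holds_inD\<close> is filled with \<open>x\<close> again.\<close>
  have neg_one: "\<not>\<^sub>r \<one> = \<zero>" "\<not>\<^sub>l \<one> = \<zero>"
    and one_le: "\<one> \<unlhd> \<not>\<^sub>r \<zero>" "\<one> \<unlhd> \<not>\<^sub>l \<zero>"
    and neg_mult: "x \<otimes> \<not>\<^sub>r (y \<otimes> x) \<unlhd> \<not>\<^sub>r y" "\<not>\<^sub>l (x \<otimes> y) \<otimes> x \<unlhd> \<not>\<^sub>l y"
    if "x \<in> carrier A" "y \<in> carrier A" for x y
    using neg[unfolded satisfies_def negation_eqs_def Let_def]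
    by (auto dest!: holds_inD[OF _ that that(1)] simp: sle_def simp del: holds_in.simps)
  have neg_join: "\<not>\<^sub>r (x \<uplus> y) \<unlhd> \<not>\<^sub>r x" "\<not>\<^sub>l (x \<uplus> y) \<unlhd> \<not>\<^sub>l x"
    if "x \<in> carrier A" "y \<in> carrier A" for x y
    using anti[unfolded satisfies_def antitone_eqs_def Let_def]
    by (auto dest!: holds_inD[OF _ that that(1)] simp: sle_def simp del: holds_in.simps)
  have trans: "x \<unlhd> z" if "x \<unlhd> y" "y \<unlhd> z" "x \<in> carrier A" "y \<in> carrier A" "z \<in> carrier A"
    for x y z
    using that join(1)[of x y z] by (simp add: sle_def)
  \<comment> \<open>Since \<open>x \<uplus> y = y\<close>, distributivity gives
    \<open>(z \<otimes> x) \<uplus> (z \<otimes> y) = z \<otimes> y\<close>, and likewise on the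
    other side.\<close>
  have mono: "z \<otimes> x \<unlhd> z \<otimes> y" "x \<otimes> z \<unlhd> y \<otimes> z"
    if "x \<unlhd> y" "x \<in> carrier A" "y \<in> carrier A" "z \<in> carrier A" for x y z
    using that distrib[of z x y] by (simp_all add: sle_def)
  \<comment> \<open>Replacing \<open>x \<uplus> y\<close> by \<open>y\<close> in
    \<open>neg_join\<close> turns the equations on joins into antitonicity.\<close>
  have neg_anti: "\<not>\<^sub>r y \<unlhd> \<not>\<^sub>r x" "\<not>\<^sub>l y \<unlhd> \<not>\<^sub>l x"
    if "x \<unlhd> y" "x \<in> carrier A" "y \<in> carrier A" for x y
    using that neg_join[of x y] by (simp_all add: sle_def)
  have rneg: "a \<otimes> b \<unlhd> \<zero> \<longleftrightarrow> b \<unlhd> \<not>\<^sub>r a" if a: "a \<in> carrier A" and b: "b \<in> carrier A" for a b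
  proof
    assume "a \<otimes> b \<unlhd> \<zero>"
    then have "\<one> \<unlhd> \<not>\<^sub>r (a \<otimes> b)"
      using one_le(1)[OF a b] neg_anti(1) trans a b closed by meson
    then have "b \<unlhd> b \<otimes> \<not>\<^sub>r (a \<otimes> b)"
      using mono(1)[of \<one> "\<not>\<^sub>r (a \<otimes> b)" b] monoid(3)[of b b b] a b closed by simp
    then show "b \<unlhd> \<not>\<^sub>r a"
      using neg_mult(1)[OF b a] trans a b closed by meson
  next
    assume "b \<unlhd> \<not>\<^sub>r a"
    then have "a \<otimes> b \<unlhd> a \<otimes> \<not>\<^sub>r a"
      using mono(1)[of b "\<not>\<^sub>r a" a] a b closed by simp
    moreover have "a \<otimes> \<not>\<^sub>r a \<unlhd> \<zero>"
      using neg_mult(1)[of a \<one>] neg_one(1)[OF a a] monoid(2)[of a a a] a closed by simp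
    ultimately show "a \<otimes> b \<unlhd> \<zero>"
      using trans a b closed by meson
  qed
  have lneg: "a \<otimes> b \<unlhd> \<zero> \<longleftrightarrow> a \<unlhd> \<not>\<^sub>l b" if a: "a \<in> carrier A" and b: "b \<in> carrier A" for a b
  proof
    assume "a \<otimes> b \<unlhd> \<zero>"
    then have "\<one> \<unlhd> \<not>\<^sub>l (a \<otimes> b)"
      using one_le(2)[OF a b] neg_anti(2) trans a b closed by meson
    then have "a \<unlhd> \<not>\<^sub>l (a \<otimes> b) \<otimes> a"
      using mono(2)[of \<one> "\<not>\<^sub>l (a \<otimes> b)" a] monoid(2)[of a a a] a b closed by simp
    then show "a \<unlhd> \<not>\<^sub>l b"
      using neg_mult(2)[OF a b] trans a b closed by meson
  next
    assume "a \<unlhd> \<not>\<^sub>l b"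
    then have "a \<otimes> b \<unlhd> \<not>\<^sub>l b \<otimes> b"
      using mono(2)[of a "\<not>\<^sub>l b" b] a b closed by simp
    \<comment> \<open>Writing \<open>b\<close> as \<open>b \<otimes> \<one>\<close> under the
      negation makes this the instance \<open>\<not>\<^sub>l (b \<otimes> \<one>) \<otimes> b
      \<unlhd> \<not>\<^sub>l \<one>\<close>.\<close>
    moreover have "\<not>\<^sub>l b \<otimes> b \<unlhd> \<zero>"
      using neg_mult(2)[of b \<one>] neg_one(2)[OF b b] monoid(3)[of b b b] b closed by simp
    ultimately show "a \<otimes> b \<unlhd> \<zero>"
      using trans a b closed by meson
  qed
  show ?thesis
    using closed join monoid distrib rneg lneg by unfold_locales (assumption | blast)+
qed

lemma PMsl_iff_satisfies:
  assumes "type_algebra A"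
  shows "A \<in> PMsl \<longleftrightarrow> satisfies A semilatticed_monoid_eqs \<and>
    satisfies A negation_eqs \<and> satisfies A antitone_eqs"
  using assms pmsl_algebraI pmsl_algebra.satisfies_semilatticed_monoid_eqs
    pmsl_algebra.satisfies_negation_eqs pmsl_algebra.satisfies_antitone_eqs
  unfolding PMsl_def by blast

text \<open>Equations do not mention the type of elements, so one and the same set axiomatises the
  class at every type. Closure then reduces to the preservation of arbitrary equations.\<close>

lemma PMsl_eq:
  "PMsl = {A. type_algebra A \<and>
    satisfies A (semilatticed_monoid_eqs \<union> negation_eqs \<union> antitone_eqs)}"
  using PMsl_iff_satisfies pmsl_algebra.axioms(1) by (auto simp: PMsl_def satisfies_Un)

section \<open>Preservation of equations by images, subalgebras and products\<close>

lemma (in type_algebra) eval_closed: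
  assumes "v \<in> UNIV \<rightarrow> carrier A"
  shows "eval A v t \<in> carrier A"
  using assms
  by (induction t)
    (auto simp: sjoin_closed mult_closed rneg_closed lneg_closed zero_closed unit_closed)

text \<open>A homomorphism respects the operations only on the carrier, so the induction relies on
  the values of all subterms lying there.\<close>

lemma (in type_algebra) eval_alg_hom:
  assumes "h \<in> alg_hom A B" and "v \<in> UNIV \<rightarrow> carrier A"
  shows "eval B (h \<circ> v) t = h (eval A v t)"
  using assms(1) eval_closed[OF assms(2)]
  by (induction t) (auto simp: alg_hom_def hom_def)

lemma satisfies_image:
  assumes "type_algebra A" "satisfies A E"
    and h: "h \<in> alg_hom A B" "h ` carrier A = carrier B"
  shows "satisfies B E"
  unfolding satisfies_def
proof
  fix e assume "e \<in> E"
  obtain s t where e: "e = (s \<^bold>\<approx> t)"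
    by (cases e)
  have "eval B v s = eval B v t" if v: "v \<in> UNIV \<rightarrow> carrier B" for v
  proof -
    \<comment> \<open>Surjectivity lets \<open>w\<close> choose a preimage of the value of each
      variable; the equation holds at \<open>w\<close> in \<open>A\<close>, and \<open>h\<close>
      carries it over to \<open>v\<close>.\<close>
    define w where "w = inv_into (carrier A) h \<circ> v"
    have hw: "h \<circ> w = v"
      using v h(2) by (auto simp: w_def fun_eq_iff intro!: f_inv_into_f)
    have w: "w \<in> UNIV \<rightarrow> carrier A"
      using v h(2) by (auto simp: w_def Pi_iff intro!: inv_into_into)
    have "eval A w s = eval A w t"
      using assms(2) \<open>e \<in> E\<close> e w by (fastforce simp: satisfies_def)
    then show ?thesis
      using type_algebra.eval_alg_hom[OF assms(1) h(1) w] hw by metis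
  qed
  then show "holds_in B e"
    by (simp add: e)
qed

lemma eval_carrier_update: "eval (A\<lparr>carrier := S\<rparr>) v t = eval A v t"
  by (induction t) simp_all

text \<open>A valuation into \<open>S\<close> is also one into \<open>carrier A\<close>, and the
  value of a term depends on the operations only.\<close>

lemma satisfies_subalgebra:
  assumes "satisfies A E" "S \<subseteq> carrier A"
  shows "satisfies (A\<lparr>carrier := S\<rparr>) E"
  unfolding satisfies_def
proof
  fix e assume "e \<in> E"
  then show "holds_in (A\<lparr>carrier := S\<rparr>) e"
    using assms by (cases e) (fastforce simp: satisfies_def eval_carrier_update)
qed

lemma type_algebra_prod:
  assumes "\<And>i. i \<in> I \<Longrightarrow> type_algebra (F i)"
  shows "type_algebra (prod_algebra I F)"
  by unfold_locales
    (auto simp: prod_algebra_def PiE_iff assms type_algebra.sjoin_closed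
      type_algebra.mult_closed type_algebra.rneg_closed type_algebra.lneg_closed
      type_algebra.zero_closed type_algebra.unit_closed)

lemma eval_prod_component:
  assumes "i \<in> I"
  shows "eval (prod_algebra I F) v t i = eval (F i) (\<lambda>n. v n i) t"
  using assms by (induction t) (simp_all add: prod_algebra_def)

lemma satisfies_prod:
  assumes "\<And>i. i \<in> I \<Longrightarrow> type_algebra (F i)" "\<And>i. i \<in> I \<Longrightarrow> satisfies (F i) E"
  shows "satisfies (prod_algebra I F) E"
  unfolding satisfies_def
proof
  fix e assume "e \<in> E"
  obtain s t where e: "e = (s \<^bold>\<approx> t)"
    by (cases e)
  \<comment> \<open>Both values are extensional functions, so it suffices to compare them on
    \<open>I\<close>, where the equation holds in each factor. This covers empty \<open>I\<close>,
    whose product has one element.\<close>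
  have "eval (prod_algebra I F) v s = eval (prod_algebra I F) v t"
    if v: "v \<in> UNIV \<rightarrow> carrier (prod_algebra I F)" for v
  proof (rule PiE_ext)
    have "eval (prod_algebra I F) v r \<in> carrier (prod_algebra I F)" for r
      using type_algebra.eval_closed[OF type_algebra_prod v] assms(1) by blast
    then show "eval (prod_algebra I F) v s \<in> (\<Pi>\<^sub>E i\<in>I. carrier (F i))"
      "eval (prod_algebra I F) v t \<in> (\<Pi>\<^sub>E i\<in>I. carrier (F i))"
      by (simp_all add: prod_algebra_def)
    fix i assume i: "i \<in> I"
    then have "(\<lambda>n. v n i) \<in> UNIV \<rightarrow> carrier (F i)"
      using v by (auto simp: prod_algebra_def)
    then show "eval (prod_algebra I F) v s i = eval (prod_algebra I F) v t i"
      using assms(2)[OF i] \<open>e \<in> E\<close> e i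
      by (fastforce simp: satisfies_def eval_prod_component)
  qed
  then show "holds_in (prod_algebra I F) e"
    by (simp add: e)
qed

theorem theorem16:
  shows "(\<forall>A :: 'a pm_algebra. type_algebra A \<longrightarrow>
           (A \<in> PMsl \<longleftrightarrow>
              satisfies A semilatticed_monoid_eqs \<and>
              satisfies A negation_eqs \<and>
              satisfies A antitone_eqs)) \<and>
         equational_class (PMsl :: 'a pm_algebra set) \<and>
         closed_under_images (PMsl :: 'a pm_algebra set) (PMsl :: 'b pm_algebra set) \<and>
         closed_under_subalgebras (PMsl :: 'a pm_algebra set) \<and>
         closed_under_products (PMsl :: 'a pm_algebra set) (PMsl :: ('i \<Rightarrow> 'a) pm_algebra set)"
proof (intro conjI allI impI)
  show "equational_class (PMsl :: 'a pm_algebra set)"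
    unfolding equational_class_def using PMsl_eq by blast
  show "closed_under_images (PMsl :: 'a pm_algebra set) (PMsl :: 'b pm_algebra set)"
    unfolding closed_under_images_def PMsl_eq using satisfies_image by blast
  show "closed_under_subalgebras (PMsl :: 'a pm_algebra set)"
    unfolding closed_under_subalgebras_def PMsl_eq using satisfies_subalgebra by blast
  \<comment> \<open>For images and subalgebras, closure under the operations is part of the
    definition; for products it comes from \<open>type_algebra_prod\<close>.\<close>
  show "closed_under_products (PMsl :: 'a pm_algebra set) (PMsl :: ('i \<Rightarrow> 'a) pm_algebra set)"
    unfolding closed_under_products_def PMsl_eq
    by (simp add: satisfies_prod type_algebra_prod)
qed (rule PMsl_iff_satisfies)

end
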